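(* Let $X_1$ and $X_2$ be skew directed lines in $\mathbb{R}^3$, and let $r_1$ and $r_2$ be rotations of infinite order about $X_1$ and $X_2$ respectively. Let $R := \{r_1, r_2\}$, let $\mathcal{W} := \mathcal{W}(R)$ be the peripatetic group generated by $R$, and let $P \in \mathbb{R}^3$. Then the orbit $P\mathcal{W} := \{Pf : f \in \mathcal{W}\}$ is dense in $\mathbb{R}^3$.
   Context: Isometries act on the right: $Pf$ is the image of the point $P$ under the isometry $f$, and for a set $M$, $Mf := \{Vf : V \in M\}$. Skew lines are lines that are neither parallel nor intersecting. A rotation about a directed line in $\mathbb{R}^3$ has a signed radian measure $\mathrm{Rad}(r)$, taken modulo $2\pi$, which is positive iff the rotation is counterclockwise as viewed looking in the direction of the line. Peripatetic group: let $R = \{r_i : i \in F\}$ be a finite set of rotations, $r_i$ having axis $A_i$ (here $F=\{1,2\}$ and $A_i = X_i$), and let $\mathcal{G}_i := \{r_i^z : z \in \mathbb{Z}\}$ be the cyclic group generated by $r_i$. For $g_i \in \mathcal{G}_i$ and an isometry $f$ of $\mathbb{R}^3$, let $fg_i$ denote the rotation about the moved axis $A_i f$ (directed by the image under $f$ of the direction of $A_i$) with $\mathrm{Rad}(fg_i) = \mathrm{Rad}(g_i)$. The operation $\star$ is defined recursively by $P(f \star g_i) := (Pf)(fg_i)$ for all points $P$, that is, first apply $f$, then apply the rotation $fg_i$; and $\iota \star f = f = f \star \iota$ for the identity isometry $\iota$. The peripatetic group $\mathcal{W}(R)$ is the set of all isometries $g_{j_1} \star g_{j_2} \star \cdots \star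 g_{j_k}$ (evaluated from left to right, $k$ finite, each $g_{j_t} \in \mathcal{G}_{j_t}$, $j_t \in F$), with operation $\star$. *)

theory Defs
  imports "HOL-Analysis.Analysis"
begin

type_synonym point = "real ^ 3"
type_synonym transf = "point \<Rightarrow> point"

text \<open>Transformations are ordinary functions: the right action written \<open>Pf\<close> on paper is \<open>f P\<close>
  here, and ``first \<open>f\<close>, then \<open>g\<close>'' is \<open>g \<circ> f\<close>.\<close>

text \<open>A directed line is given by one of its points and its unit direction vector.\<close>

datatype dline = DLine (base: point) (dir: point)

definition directed_line :: "dline \<Rightarrow> bool" where
  "directed_line L \<longleftrightarrow> norm (dir L) = 1"

definition points :: "dline \<Rightarrow> point set" where
  "points L = {base L + t *\<^sub>R dir L | t. True}"

definition parallel :: "dline \<Rightarrow> dline \<Rightarrow> bool" where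
  "parallel L M \<longleftrightarrow> (\<exists>c. dir L = c *\<^sub>R dir M)"

definition skew :: "dline \<Rightarrow> dline \<Rightarrow> bool" where
  "skew L M \<longleftrightarrow> \<not> parallel L M \<and> points L \<inter> points M = {}"

text \<open>For an isometry \<open>f\<close> this is the image line, directed by the image of the direction.\<close>

definition dline_image :: "transf \<Rightarrow> dline \<Rightarrow> dline" where
  "dline_image f L = DLine (f (base L)) (f (base L + dir L) - f (base L))"

text \<open>Rodrigues' formula. A positive angle is counterclockwise for an observer looking in the
  direction of the line (rather than one towards whom the line points), which is the opposite of
  the right-hand rule; hence the minus sign.\<close>

definition rotation :: "dline \<Rightarrow> real \<Rightarrow> transf" where
  "rotation L \<theta> x =
    (let u = dir L; v = x - base L in
      base L + cos \<theta> *\<^sub>R v + ((1 - cos \<theta>) * (u \<bullet> v)) *\<^sub>R u - sin \<theta> *\<^sub>R cross3 u v)"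

definition rotation_about :: "dline \<Rightarrow> transf \<Rightarrow> bool" where
  "rotation_about L r \<longleftrightarrow> (\<exists>\<theta>. r = rotation L \<theta>)"

text \<open>The signed radian measure, represented modulo \<open>2\<pi>\<close> by its value in \<open>(-\<pi>, \<pi>]\<close>.\<close>

definition Rad :: "dline \<Rightarrow> transf \<Rightarrow> real" where
  "Rad L r = (THE \<theta>. - pi < \<theta> \<and> \<theta> \<le> pi \<and> r = rotation L \<theta>)"

definition zpower :: "transf \<Rightarrow> int \<Rightarrow> transf" where
  "zpower r z = (if 0 \<le> z then r ^^ nat z else inv r ^^ nat (- z))"

definition infinite_order :: "transf \<Rightarrow> bool" where
  "infinite_order r \<longleftrightarrow> (\<forall>n>0. r ^^ n \<noteq> id)"

text \<open>\<open>moved A f g\<close> is the rotation written \<open>fg\<close> on paper, for a rotation \<open>g\<close> about \<open>A\<close>; the axis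
  is an explicit argument since a rotation does not determine the direction of its axis.\<close>

definition moved :: "dline \<Rightarrow> transf \<Rightarrow> transf \<Rightarrow> transf" where
  "moved A f g = rotation (dline_image f A) (Rad A g)"

definition star :: "dline \<Rightarrow> transf \<Rightarrow> transf \<Rightarrow> transf" where
  "star A f g = moved A f g \<circ> f"

text \<open>The elements of the peripatetic group of a set of rotations, each paired with its directed
  axis. The rule \<open>star\<close> appends a last factor, so products are evaluated from left to right; the
  first factor enters as \<open>\<iota> \<star> g = g\<close>.\<close>

inductive_set peripatetic :: "(dline \<times> transf) set \<Rightarrow> transf set"
  for R :: "(dline \<times> transf) set" where
  id: "id \<in> peripatetic R"
| star: "\<lbrakk>f \<in> peripatetic R; (A, r) \<in> R; g \<in> range (zpower r)\<rbrakk> \<Longrightarrow> star A f g \<in> peripatetic R"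

lemma rotation_eqD:
  assumes L: "directed_line L" and eq: "rotation L a = rotation L b"
  shows "cos a = cos b \<and> sin a = sin b"
proof -
  let ?u = "dir L"
  have u: "?u \<bullet> ?u = 1" using L by (simp add: directed_line_def norm_eq_1)
  obtain w :: point where w: "w \<noteq> 0" "?u \<bullet> w = 0"
    using orthogonal_to_vector_exists[of ?u] by (auto simp: orthogonal_def)
  have e: "cos a *\<^sub>R w - sin a *\<^sub>R cross3 ?u w = cos b *\<^sub>R w - sin b *\<^sub>R cross3 ?u w"
    using fun_cong[OF eq, of "base L + w"] w by (simp add: rotation_def Let_def)
  have c: "cos a = cos b"
    using arg_cong[OF e, of "\<lambda>v. v \<bullet> w"] w
    by (simp add: inner_diff_left dot_cross_self)
  have "cross3 ?u w \<noteq> 0"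
    using norm_and_cross_eq_0[of ?u w] u w by auto
  with e c show ?thesis by simp
qed

lemma Rad_rotation:
  assumes L: "directed_line L" and \<theta>: "- pi < \<theta>" "\<theta> \<le> pi"
  shows "Rad L (rotation L \<theta>) = \<theta>"
  unfolding Rad_def
proof (rule the_equality)
  fix t assume "- pi < t \<and> t \<le> pi \<and> rotation L \<theta> = rotation L t"
  then show "t = \<theta>"
    using rotation_eqD[OF L, of t \<theta>] \<theta> cis_Arg_unique[of "cis \<theta>" t]
      cis_Arg_unique[of "cis \<theta>" \<theta>] by (simp add: complex_eq_iff)
qed (use \<theta> in simp)

lemma rotation_Rad:
  assumes L: "directed_line L" and "rotation_about L r"
  shows "rotation L (Rad L r) = r"
proof -
  obtain \<theta> where r: "r = rotation L \<theta>" using assms by (auto simp: rotation_about_def)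
  let ?t = "Arg (cis \<theta>)"
  have "cis ?t = cis \<theta>" by (simp add: cis_Arg sgn_cis)
  then have "cos ?t = cos \<theta>" "sin ?t = sin \<theta>" by (simp_all add: complex_eq_iff)
  then have "r = rotation L ?t" by (simp add: r rotation_def fun_eq_iff)
  moreover have "- pi < ?t" "?t \<le> pi" by (simp_all add: mpi_less_Arg Arg_le_pi)
  ultimately show ?thesis using Rad_rotation[OF L] by metis
qed

end

theory Submission
  imports Defs
begin

text \<open>
  For an orientation-preserving isometry \<open>f\<close> and a rotation \<open>g\<close> about \<open>A\<close>, the moved rotation
  \<open>moved A f g\<close> is the conjugate of \<open>g\<close> by \<open>f\<close>
  (\<open>rigid_rotation_image\<close>), so \<open>star A f g = f \<circ> g\<close>, and the peripatetic group is just the group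
  generated by \<open>r\<^sub>1\<close> and \<open>r\<^sub>2\<close> under composition. Let \<open>C\<close> be the closure of the orbit of \<open>P\<close>; it is
  mapped into itself by \<open>r\<^sub>1\<close> and \<open>r\<^sub>2\<close>. It remains to see that a nonempty closed set with this
  property is the whole space (\<open>invariant_eq_UNIV\<close>, once all angles are available).

  A rotation of infinite order turns by an irrational multiple of \<open>2\<pi>\<close>, so by Kronecker's theorem
  the closed set \<open>C\<close> is preserved by every rotation about \<open>X\<^sub>1\<close> and about \<open>X\<^sub>2\<close>
  (\<open>infinite_order_axes\<close>). Consider all directed lines such that every rotation about them preserves
  \<open>C\<close>. Conjugation shows that this family is closed under the rotations about its own
  members. Its set of directions is therefore closed under rotating one member about another; since
  it contains two independent directions, it is the whole unit sphere
  (\<open>rot_closed_eq_sphere\<close>).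

  In particular the family has a line \<open>L\<close> perpendicular to both \<open>X\<^sub>1\<close> and \<open>X\<^sub>2\<close>. Some rotation about
  \<open>L\<close> takes \<open>X\<^sub>1\<close> to a line \<open>Y\<close> with the direction of \<open>X\<^sub>2\<close>. Heights along \<open>L\<close> do not change, and
  skew lines have different heights along their common perpendicular, so \<open>Y\<close> and \<open>X\<^sub>2\<close> are
  distinct parallel lines. The product of the half-turns about them is a nonzero translation
  preserving \<open>C\<close> (\<open>nonzero_translation\<close>). Conjugating it by rotations in all directions gives every
  translation of that length, and sums of these are all translations. Hence \<open>C\<close> is everything.
\<close>

section \<open>Rotations of vectors about a unit vector\<close>

text \<open>The linear part of \<open>rotation\<close>, with the same sign convention for the angle: rotation of the
  vector \<open>v\<close> by \<open>\<theta>\<close> about \<open>u\<close>. It is meant for unit vectors \<open>u\<close>.\<close>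

definition rot :: "point \<Rightarrow> real \<Rightarrow> transf" where
  "rot u \<theta> v = cos \<theta> *\<^sub>R v + ((1 - cos \<theta>) * (u \<bullet> v)) *\<^sub>R u - sin \<theta> *\<^sub>R cross3 u v"

lemma rotation_eq_rot: "rotation L \<theta> x = base L + rot (dir L) \<theta> (x - base L)"
  by (simp add: rotation_def rot_def Let_def)

lemma linear_rot: "linear (rot u \<theta>)"
  by (rule linearI)
    (simp_all add: rot_def cross_add_right cross_mult_right inner_right_distrib algebra_simps)

lemma rot_zero [simp]: "rot u 0 v = v"
  by (simp add: rot_def)

lemma inner_axis_rot: "norm u = 1 \<Longrightarrow> u \<bullet> rot u \<theta> v = u \<bullet> v"
  by (simp add: rot_def inner_diff_right inner_add_right dot_cross_self norm_eq_1 algebra_simps)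

lemma rot_rot:
  assumes "norm u = 1"
  shows "rot u s (rot u t v) = rot u (s + t) v"
proof -
  have u: "u \<bullet> u = 1" using assms by (simp add: norm_eq_1)
  note h = inner_axis_rot[OF assms]
  have c: "cross3 u (rot u t v) = cos t *\<^sub>R cross3 u v + sin t *\<^sub>R v - (sin t * (u \<bullet> v)) *\<^sub>R u"
    by (simp add: rot_def cross_add_right Cross3.right_diff_distrib cross_mult_right Lagrange u
        algebra_simps)
  have "rot u s (rot u t v) = cos s *\<^sub>R rot u t v + ((1 - cos s) * (u \<bullet> v)) *\<^sub>R u
      - sin s *\<^sub>R (cos t *\<^sub>R cross3 u v + sin t *\<^sub>R v - (sin t * (u \<bullet> v)) *\<^sub>R u)"
    by (subst rot_def) (simp add: h c)
  also have "\<dots> = rot u (s + t) v"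
    by (simp add: rot_def cos_add sin_add algebra_simps)
  finally show ?thesis .
qed

lemma norm_rot:
  assumes "norm u = 1"
  shows "norm (rot u \<theta> v) = norm v"
proof -
  define w where "w = v - (u \<bullet> v) *\<^sub>R u"
  have u: "u \<bullet> u = 1" using assms by (simp add: norm_eq_1)
  have uw: "u \<bullet> w = 0" by (simp add: w_def inner_diff_right u)
  have ww: "cross3 u w \<bullet> cross3 u w = w \<bullet> w"
    by (simp add: dot_cross u uw)
  have v: "v = (u \<bullet> v) *\<^sub>R u + w" by (simp add: w_def)
  have r: "rot u \<theta> v = (u \<bullet> v) *\<^sub>R u + cos \<theta> *\<^sub>R w - sin \<theta> *\<^sub>R cross3 u w"
    by (simp add: rot_def w_def Cross3.right_diff_distrib cross_mult_right algebra_simps)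
  have "rot u \<theta> v \<bullet> rot u \<theta> v = (u \<bullet> v)\<^sup>2 + ((cos \<theta>)\<^sup>2 + (sin \<theta>)\<^sup>2) * (w \<bullet> w)"
    unfolding r distrib_right
    by (simp add: inner_diff_left inner_diff_right inner_add_left inner_add_right u uw
        inner_commute[of w u] dot_cross_self ww power2_eq_square algebra_simps
        del: sin_cos_squared_add sin_cos_squared_add2 sin_cos_squared_add3)
  moreover have "v \<bullet> v = (u \<bullet> v)\<^sup>2 + w \<bullet> w"
    by (subst (1 2) v)
      (simp add: inner_add_left inner_add_right u uw inner_commute[of w u] power2_eq_square)
  ultimately show ?thesis by (simp add: norm_eq_sqrt_inner)
qed

lemma orthogonal_transformation_rot:
  "norm u = 1 \<Longrightarrow> orthogonal_transformation (rot u \<theta>)"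
  by (simp add: orthogonal_transformation linear_rot norm_rot)

lemma det_rot:
  assumes "norm u = 1"
  shows "det (matrix (rot u \<theta>)) = 1"
proof -
  \<comment> \<open>A rotation is the square of the rotation by half the angle, so its determinant, which is
    \<open>1\<close> or \<open>-1\<close>, is a square.\<close>
  let ?h = "rot u (\<theta> / 2)"
  have "rot u \<theta> = ?h \<circ> ?h" by (simp add: fun_eq_iff rot_rot[OF assms])
  then have "det (matrix (rot u \<theta>)) = det (matrix ?h) * det (matrix ?h)"
    by (simp add: matrix_compose linear_rot det_mul)
  also have "\<dots> = \<bar>det (matrix ?h)\<bar> * \<bar>det (matrix ?h)\<bar>" by simp
  also have "\<dots> = 1"
    using orthogonal_transformation_det[OF orthogonal_transformation_rot[OF assms, of "\<theta> / 2"]]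
    by simp
  finally show ?thesis .
qed

lemma cross_rot:
  "norm u = 1 \<Longrightarrow> cross3 (rot u \<theta> x) (rot u \<theta> y) = rot u \<theta> (cross3 x y)"
  by (simp add: cross_linear_image linear_rot norm_rot det_rot)

text \<open>Rotations about \<open>u\<close> act transitively on each circle about \<open>u\<close>.\<close>

lemma rot_circle:
  assumes u: "norm u = 1" and h: "u \<bullet> v = u \<bullet> w" and n: "norm v = norm w"
  obtains \<theta> where "rot u \<theta> v = w"
proof -
  define v' where "v' = v - (u \<bullet> v) *\<^sub>R u"
  define w' where "w' = w - (u \<bullet> w) *\<^sub>R u"
  have uu: "u \<bullet> u = 1" using u by (simp add: norm_eq_1)
  have uv: "u \<bullet> v' = 0" and uw: "u \<bullet> w' = 0"
    by (simp_all add: v'_def w'_def inner_diff_right uu)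
  have vv: "v' \<bullet> v' = w' \<bullet> w'"
    using h n by (simp add: v'_def w'_def inner_diff_left inner_diff_right uu norm_eq
        inner_commute[of v u] inner_commute[of w u] algebra_simps)
  define q where "q = v' \<bullet> v'"
  have r: "rot u t v = (u \<bullet> w) *\<^sub>R u + cos t *\<^sub>R v' - sin t *\<^sub>R cross3 u v'" for t
    by (simp add: rot_def v'_def h Cross3.right_diff_distrib cross_mult_right algebra_simps)
  show ?thesis
  proof (cases "q = 0")
    case True
    then have "v' = 0" "w' = 0" using vv by (simp_all add: q_def)
    then have "rot u 0 v = w" unfolding r by (simp add: w'_def)
    then show ?thesis by (rule that)
  next
    case False
    \<comment> \<open>Coordinates of \<open>w'\<close> in the basis \<open>v'\<close>, \<open>- cross3 u v'\<close> of the plane perpendicular to \<open>u\<close>;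
      they will be the cosine and sine of the angle.\<close>
    define a b where "a = v' \<bullet> w' / q" and "b = - (cross3 u v' \<bullet> w') / q"
    have "cross3 u (cross3 w' v') = 0" by (simp add: Lagrange uv uw)
    then have k: "cross3 w' v' = (u \<bullet> cross3 w' v') *\<^sub>R u"
      using Lagrange[of u u "cross3 w' v'"] uu
      by (metis (no_types) Lagrange eq_iff_diff_eq_0 scaleR_one)
    have "q *\<^sub>R w' - (v' \<bullet> w') *\<^sub>R v' = cross3 v' (cross3 w' v')"
      by (simp add: Lagrange q_def)
    also have "\<dots> = - ((u \<bullet> cross3 w' v') *\<^sub>R cross3 u v')"
      by (subst k) (simp add: cross_mult_right cross_skew[of v' u])
    also have "u \<bullet> cross3 w' v' = - (cross3 u v' \<bullet> w')"
      by (simp add: cross3_simps)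
    finally have e: "q *\<^sub>R w' = (v' \<bullet> w') *\<^sub>R v' + (cross3 u v' \<bullet> w') *\<^sub>R cross3 u v'"
      by (simp add: algebra_simps)
    have "w' = (1 / q) *\<^sub>R (q *\<^sub>R w')" using False by simp
    also have "\<dots> = a *\<^sub>R v' - b *\<^sub>R cross3 u v'"
      unfolding e a_def b_def by (simp add: algebra_simps)
    finally have w': "w' = a *\<^sub>R v' - b *\<^sub>R cross3 u v'" .
    have "q = w' \<bullet> w'" using vv by (simp add: q_def)
    also have "\<dots> = (a\<^sup>2 + b\<^sup>2) * q"
      unfolding w' by (simp add: inner_diff_left inner_diff_right dot_cross_self dot_cross uu uv
          power2_eq_square algebra_simps flip: q_def)
    finally have "a\<^sup>2 + b\<^sup>2 = 1" using False by simp
    then obtain t where "a = cos t" "b = sin t" using sincos_total_2pi by metis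
    then have "rot u t v = w" unfolding r using w' by (simp add: w'_def algebra_simps)
    then show ?thesis by (rule that)
  qed
qed

text \<open>A set of unit vectors that contains two independent vectors, and with any two of its members
  the rotations of one about the other, is the whole unit sphere. Rotating one of two members at
  angular distance \<open>a \<le> \<pi>/2\<close> about the other yields members at every distance from \<open>0\<close> to \<open>2a\<close>.
  Doubling often enough gives an orthogonal pair, and rotations about suitable members then reach
  every unit vector.\<close>

lemma rot_closed_eq_sphere:
  fixes Q :: "point set"
  assumes unit: "\<And>v. v \<in> Q \<Longrightarrow> norm v = 1"
    and rot: "\<And>u v \<theta>. u \<in> Q \<Longrightarrow> v \<in> Q \<Longrightarrow> rot u \<theta> v \<in> Q"
    and u1: "u1 \<in> Q" and u2: "u2 \<in> Q" and np: "\<bar>u1 \<bullet> u2\<bar> < 1"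
    and y: "norm y = 1"
  shows "y \<in> Q"
proof -
  have circ: "w \<in> Q" if "u \<in> Q" "v \<in> Q" "norm w = 1" "u \<bullet> w = u \<bullet> v" for u v w
    using rot_circle[of u v w] that unit rot by metis
  have angle: "w \<bullet> rot v t w = (v \<bullet> w)\<^sup>2 + cos t * (1 - (v \<bullet> w)\<^sup>2)"
    if "w \<in> Q" for v w t
    using unit[OF that]
    by (simp add: rot_def inner_diff_right inner_add_right dot_cross_self norm_eq_1
        inner_commute[of w v] power2_eq_square algebra_simps)
  \<comment> \<open>If \<open>c\<close> is the cosine of the distance, \<open>2c\<^sup>2 - 1\<close> is the cosine of the doubled distance; when
    this is negative a smaller angle of rotation gives an orthogonal pair.\<close>
  have step: "\<exists>v\<in>Q. \<exists>w\<in>Q. v \<bullet> w = max 0 (2 * c\<^sup>2 - 1)"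
    if v: "v \<in> Q" and w: "w \<in> Q" and c: "v \<bullet> w = c" "\<bar>c\<bar> < 1" for v w c
  proof -
    define m where "m = max 0 (2 * c\<^sup>2 - 1)"
    have c2: "c\<^sup>2 < 1" using c by (simp add: abs_square_less_1)
    then have "\<bar>(m - c\<^sup>2) / (1 - c\<^sup>2)\<bar> \<le> 1"
      unfolding abs_le_iff by (simp add: m_def divide_simps)
    then have "cos (arccos ((m - c\<^sup>2) / (1 - c\<^sup>2))) = (m - c\<^sup>2) / (1 - c\<^sup>2)"
      by (simp add: cos_arccos_abs)
    then have "w \<bullet> rot v (arccos ((m - c\<^sup>2) / (1 - c\<^sup>2))) w = m"
      using angle[OF w, of v] c c2 by simp
    then show ?thesis using rot[OF v w] w unfolding m_def by blast
  qed
  \<comment> \<open>For \<open>0 \<le> c\<close> a step that does not reach an orthogonal pair at least doubles \<open>1 - c\<close>, because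
    \<open>1 - (2c\<^sup>2 - 1) = 2 (1 - c) (1 + c)\<close>.\<close>
  have orth: "\<exists>v\<in>Q. \<exists>w\<in>Q. v \<bullet> w = 0"
    if "v \<in> Q" "w \<in> Q" "v \<bullet> w = c" "0 \<le> c" "c < 1" "1 \<le> 2 ^ k * (1 - c)" for v w c k
    using that
  proof (induction k arbitrary: v w c)
    case 0
    then have "c = 0" by simp
    then show ?case using 0 by blast
  next
    case (Suc k)
    obtain v' w' where v': "v' \<in> Q" "w' \<in> Q" "v' \<bullet> w' = max 0 (2 * c\<^sup>2 - 1)"
      using step[of v w c] Suc.prems by auto
    show ?case
    proof (cases "2 * c\<^sup>2 \<le> 1")
      case True
      then show ?thesis using v' by (metis diff_le_0_iff_le max.absorb1)
    next
      case False
      have c2: "c\<^sup>2 \<le> c" using Suc.prems by (simp add: power2_eq_square mult_left_le)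
      have "1 \<le> 2 ^ k * (2 * (1 - c))" using Suc.prems by (simp add: algebra_simps)
      also have "\<dots> \<le> 2 ^ k * (1 - (2 * c\<^sup>2 - 1))"
        using c2 by (intro mult_left_mono) auto
      finally show ?thesis
        using Suc.IH[of v' w' "2 * c\<^sup>2 - 1"] v' False c2 Suc.prems by force
    qed
  qed
  obtain v w c where vw: "v \<in> Q" "w \<in> Q" "v \<bullet> w = c" "0 \<le> c" "c < 1"
  proof -
    have "(u1 \<bullet> u2)\<^sup>2 < 1" using np by (simp add: abs_square_less_1)
    then show ?thesis using step[OF u1 u2 refl np] that by force
  qed
  obtain k :: nat where "1 / (1 - c) < 2 ^ k"
    using real_arch_pow[of 2 "1 / (1 - c)"] by auto
  then have "1 \<le> 2 ^ k * (1 - c)" using vw by (simp add: divide_simps)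
  then obtain v w where v: "v \<in> Q" and w: "w \<in> Q" and "v \<bullet> w = 0"
    using orth vw by metis
  \<comment> \<open>A unit vector \<open>x\<close> perpendicular to \<open>v\<close> and \<open>y\<close> comes from \<open>w\<close> by a rotation about \<open>v\<close>, and
    \<open>y\<close> from \<open>v\<close> by a rotation about \<open>x\<close>.\<close>
  have "\<exists>x. x \<bullet> v = 0 \<and> x \<bullet> y = 0 \<and> norm x = 1"
  proof -
    obtain z where z: "z \<noteq> 0" "z \<bullet> v = 0" "z \<bullet> y = 0"
    proof (cases "cross3 v y = 0")
      case False
      then show ?thesis using that[of "cross3 v y"] by (simp add: dot_cross_self)
    next
      case True
      have vn: "norm v = 1" "v \<bullet> v = 1" using unit[OF v] by (simp_all add: norm_eq_1)
      have "w \<bullet> y = 0"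
      proof -
        have "(v \<bullet> y) *\<^sub>R v = y"
          using Lagrange[of v v y] True vn by simp
        then show ?thesis using \<open>v \<bullet> w = 0\<close> by (metis inner_commute inner_scaleR_right mult_zero_right)
      qed
      moreover have "w \<noteq> 0" using unit[OF w] by auto
      ultimately show ?thesis using that[of w] \<open>v \<bullet> w = 0\<close> by (simp add: inner_commute)
    qed
    then show ?thesis by (intro exI[of _ "z /\<^sub>R norm z"]) simp
  qed
  then obtain x where x: "x \<bullet> v = 0" "x \<bullet> y = 0" "norm x = 1" by blast
  have "x \<in> Q" using circ[OF v w x(3)] x \<open>v \<bullet> w = 0\<close> by (simp add: inner_commute)
  then show ?thesis using circ[OF _ v y] x by simp
qed

section \<open>Rotations about directed lines\<close>

lemma inner_axis_rotation:
  "directed_line L \<Longrightarrow> dir L \<bullet> rotation L \<theta> x = dir L \<bullet> x"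
  by (simp only: rotation_eq_rot inner_add_right inner_diff_right inner_axis_rot directed_line_def
      add_diff_cancel_left' add_diff_eq)

lemma rotation_zero [simp]: "rotation L 0 = id"
  by (simp add: fun_eq_iff rotation_eq_rot)

lemma rotation_rotation:
  "directed_line L \<Longrightarrow> rotation L s (rotation L t x) = rotation L (s + t) x"
  by (simp add: rotation_eq_rot rot_rot directed_line_def)

lemma rotation_funpow:
  "directed_line L \<Longrightarrow> rotation L t ^^ n = rotation L (real n * t)"
  by (induction n) (simp_all add: fun_eq_iff rotation_rotation algebra_simps)

lemma inv_rotation: "directed_line L \<Longrightarrow> inv (rotation L t) = rotation L (- t)"
  by (rule inv_unique_comp) (simp_all add: fun_eq_iff rotation_rotation)

lemma rotation_about_zpower:
  assumes "directed_line L" and "rotation_about L r"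
  shows "rotation_about L (zpower r z)"
  using assms by (auto simp: rotation_about_def zpower_def inv_rotation rotation_funpow)

text \<open>Skew lines have a nonzero separation along their common perpendicular direction: otherwise
  the vector joining their base points is a combination of the two directions, and the
  lines meet.\<close>

lemma skew_cross_nonzero:
  assumes "directed_line X1" "directed_line X2" "skew X1 X2"
  shows "(base X2 - base X1) \<bullet> cross3 (dir X1) (dir X2) \<noteq> 0"
proof
  define u v d where "u = dir X1" and "v = dir X2" and "d = base X2 - base X1"
  define N where "N = cross3 u v"
  assume "(base X2 - base X1) \<bullet> cross3 (dir X1) (dir X2) = 0"
  then have 0: "d \<bullet> N = 0" by (simp add: u_def v_def d_def N_def)
  have v1: "v \<bullet> v = 1" using assms by (simp add: v_def directed_line_def norm_eq_1)
  have "N \<noteq> 0"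
  proof
    assume "N = 0"
    then have "u = (u \<bullet> v) *\<^sub>R v"
      using Lagrange[of v u v] v1 by (simp add: N_def inner_commute)
    then show False using assms(3) by (auto simp: skew_def parallel_def u_def v_def)
  qed
  define a b where "a = (cross3 d v \<bullet> N) / (N \<bullet> N)" and "b = (cross3 u d \<bullet> N) / (N \<bullet> N)"
  \<comment> \<open>Cramer's rule for \<open>d\<close> in the basis \<open>u\<close>, \<open>v\<close>, \<open>N\<close>.\<close>
  have "(N \<bullet> N) *\<^sub>R d = (d \<bullet> N) *\<^sub>R N + (cross3 d v \<bullet> N) *\<^sub>R u + (cross3 u d \<bullet> N) *\<^sub>R v"
    unfolding N_def by (simp add: vec_eq_iff forall_3 cross_components inner_vec_def sum_3 algebra_simps)
  then have "(N \<bullet> N) *\<^sub>R d = (N \<bullet> N) *\<^sub>R (a *\<^sub>R u + b *\<^sub>R v)"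
    using \<open>N \<noteq> 0\<close> by (simp add: 0 a_def b_def scaleR_add_right)
  then have "d = a *\<^sub>R u + b *\<^sub>R v" using \<open>N \<noteq> 0\<close> by simp
  then have e: "base X1 + a *\<^sub>R dir X1 = base X2 + (- b) *\<^sub>R dir X2"
    by (simp add: d_def u_def v_def algebra_simps)
  have "base X1 + a *\<^sub>R dir X1 \<in> points X1" by (auto simp: points_def)
  moreover have "base X1 + a *\<^sub>R dir X1 \<in> points X2" unfolding e points_def by blast
  ultimately show False using assms(3) by (auto simp: skew_def)
qed

text \<open>The product of the half-turns about two parallel lines is the translation by twice the
  vector leading perpendicularly from the first line to the second.\<close>

lemma half_turns_parallel:
  assumes "directed_line L" "dir L = dir M"
  shows "rotation M pi (rotation L pi x)
    = x + 2 *\<^sub>R (base M - base L - (dir M \<bullet> (base M - base L)) *\<^sub>R dir M)"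
proof -
  have "dir M \<bullet> rotation L pi x = dir M \<bullet> x"
    using inner_axis_rotation[OF assms(1)] assms(2) by simp
  then have M: "rotation M pi (rotation L pi x)
      = base M - (rotation L pi x - base M) + (2 * (dir M \<bullet> x - dir M \<bullet> base M)) *\<^sub>R dir M"
    by (simp add: rotation_eq_rot[of M] rot_def inner_diff_right)
  have "rotation L pi x
      = base L - (x - base L) + (2 * (dir M \<bullet> x - dir M \<bullet> base L)) *\<^sub>R dir M"
    by (simp add: rotation_eq_rot rot_def assms(2) inner_diff_right)
  then show ?thesis
    unfolding M by (simp add: vec_eq_iff inner_diff_right algebra_simps)
qed

section \<open>The peripatetic group is generated under composition\<close>

text \<open>Orientation-preserving isometries; preservation of orientation is expressed by letting the
  linear part commute with the cross product.\<close>

definition rigid :: "transf \<Rightarrow> bool" where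
  "rigid f \<longleftrightarrow> (\<exists>b A. f = (\<lambda>x. b + A x) \<and> orthogonal_transformation A \<and>
    (\<forall>x y. cross3 (A x) (A y) = A (cross3 x y)))"

lemma rigid_id: "rigid id"
  unfolding rigid_def by (intro exI[of _ 0] exI[of _ "\<lambda>x. x"]) (simp add: id_def)

lemma rigid_compose:
  assumes "rigid f" and "rigid g"
  shows "rigid (f \<circ> g)"
proof -
  obtain b A where f: "f = (\<lambda>x. b + A x)" and A: "orthogonal_transformation A"
    "\<And>x y. cross3 (A x) (A y) = A (cross3 x y)" using assms(1) by (auto simp: rigid_def)
  obtain c B where g: "g = (\<lambda>x. c + B x)" and B: "orthogonal_transformation B"
    "\<And>x y. cross3 (B x) (B y) = B (cross3 x y)" using assms(2) by (auto simp: rigid_def)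
  have "f \<circ> g = (\<lambda>x. (b + A c) + (A \<circ> B) x)"
    using A(1) by (simp add: f g fun_eq_iff orthogonal_transformation_def linear_add)
  then show ?thesis
    using orthogonal_transformation_compose[OF A(1) B(1)] A(2) B(2) unfolding rigid_def
    by (metis comp_apply)
qed

lemma rigid_rotation:
  assumes "directed_line L"
  shows "rigid (rotation L \<theta>)"
proof -
  let ?A = "rot (dir L) \<theta>"
  have u: "norm (dir L) = 1" using assms by (simp add: directed_line_def)
  have "rotation L \<theta> = (\<lambda>x. (base L - ?A (base L)) + ?A x)"
    by (simp add: fun_eq_iff rotation_eq_rot linear_diff[OF linear_rot])
  then show ?thesis
    using orthogonal_transformation_rot[OF u] cross_rot[OF u] unfolding rigid_def by blast
qed

text \<open>Conjugating a rotation by an orientation-preserving isometry moves its axis and keeps its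
  angle.\<close>

lemma rigid_rotation_image:
  assumes "rigid f"
  shows "rotation (dline_image f L) \<theta> (f x) = f (rotation L \<theta> x)"
proof -
  obtain b A where f: "f = (\<lambda>x. b + A x)" and A: "orthogonal_transformation A"
    "\<And>x y. cross3 (A x) (A y) = A (cross3 x y)" using assms by (auto simp: rigid_def)
  have lin: "linear A" and inner: "\<And>x y. A x \<bullet> A y = x \<bullet> y"
    using A(1) by (auto simp: orthogonal_transformation_def)
  have "rotation (dline_image f L) \<theta> (f x)
      = b + A (base L) + rot (A (dir L)) \<theta> (A (x - base L))"
    by (simp add: rotation_eq_rot dline_image_def f linear_add[OF lin] linear_diff[OF lin])
  also have "rot (A (dir L)) \<theta> (A (x - base L)) = A (rot (dir L) \<theta> (x - base L))"
    unfolding rot_def inner A(2) linear_add[OF lin] linear_diff[OF lin, of "_ + _"]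
      linear_cmul[OF lin] ..
  also have "b + A (base L) + \<dots> = f (rotation L \<theta> x)"
    by (simp add: rotation_eq_rot f linear_add[OF lin])
  finally show ?thesis .
qed

lemma star_eq_comp:
  assumes "rigid f" and "directed_line A" and "rotation_about A g"
  shows "star A f g = f \<circ> g"
  by (simp add: fun_eq_iff star_def moved_def rigid_rotation_image[OF assms(1)]
      rotation_Rad[OF assms(2,3)])

lemma peripatetic_rigid:
  assumes R: "\<And>A r. (A, r) \<in> R \<Longrightarrow> directed_line A \<and> rotation_about A r"
    and "f \<in> peripatetic R"
  shows "rigid f"
  using assms(2)
proof induction
  case id
  show ?case by (rule rigid_id)
next
  case (star f A r g)
  then have A: "directed_line A" and g: "rotation_about A g"
    using R rotation_about_zpower by blast+
  then have "rigid g" by (auto simp: rotation_about_def rigid_rotation)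
  then show ?case
    unfolding star_eq_comp[OF star.IH A g] using star.IH by (intro rigid_compose)
qed

text \<open>In terms of composition \<open>star\<close> puts new factors on the right, whereas the invariance of an orbit
  is about factors on the left.\<close>

lemma peripatetic_comp_left:
  assumes R: "\<And>A r. (A, r) \<in> R \<Longrightarrow> directed_line A \<and> rotation_about A r"
    and Ar: "(A, r) \<in> R" and "f \<in> peripatetic R"
  shows "r \<circ> f \<in> peripatetic R"
  using assms(3)
proof induction
  case id
  have "r \<in> range (zpower r)"
    by (rule range_eqI[of _ _ 1]) (simp add: zpower_def)
  then have "star A id r \<in> peripatetic R"
    using Ar by (intro peripatetic.star peripatetic.id)
  then show ?case using R[OF Ar] by (simp add: star_eq_comp rigid_id)
next
  case (star f B s g)
  have B: "directed_line B" and g: "rotation_about B g"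
    using star.hyps R rotation_about_zpower by blast+
  have "star B (r \<circ> f) g \<in> peripatetic R"
    using star by (intro peripatetic.star)
  moreover have "star B (r \<circ> f) g = r \<circ> star B f g"
    using star_eq_comp[OF peripatetic_rigid[OF R star.IH] B g]
      star_eq_comp[OF peripatetic_rigid[OF R star.hyps(1)] B g] by (simp add: comp_def)
  ultimately show ?case by (simp only:)
qed

section \<open>Axes of symmetry of a set\<close>

text \<open>The directed lines about which every rotation maps \<open>C\<close> into itself. As the inverse of a
  rotation is a rotation about the same line, these rotations even map \<open>C\<close> onto itself.\<close>

definition axes :: "point set \<Rightarrow> dline set" where
  "axes C = {L. directed_line L \<and> (\<forall>\<theta>. \<forall>x\<in>C. rotation L \<theta> x \<in> C)}"

lemma axes_directed: "L \<in> axes C \<Longrightarrow> directed_line L"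
  by (simp add: axes_def)

lemma axes_rotation: "L \<in> axes C \<Longrightarrow> x \<in> C \<Longrightarrow> rotation L \<theta> x \<in> C"
  by (simp add: axes_def)

lemma dline_image_rotation:
  "base (dline_image (rotation L \<theta>) M) = rotation L \<theta> (base M)"
  "dir (dline_image (rotation L \<theta>) M) = rot (dir L) \<theta> (dir M)"
  by (simp_all add: dline_image_def rotation_eq_rot flip: linear_diff[OF linear_rot])

lemma axes_image:
  assumes L: "L \<in> axes C" and M: "M \<in> axes C"
  shows "dline_image (rotation L \<theta>) M \<in> axes C"
proof -
  have "rotation (dline_image (rotation L \<theta>) M) t x \<in> C" if x: "x \<in> C" for t x
  proof -
    have "x = rotation L \<theta> (rotation L (- \<theta>) x)"
      using axes_directed[OF L] by (simp add: rotation_rotation)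
    then have "rotation (dline_image (rotation L \<theta>) M) t x
        = rotation L \<theta> (rotation M t (rotation L (- \<theta>) x))"
      by (metis rigid_rotation_image rigid_rotation axes_directed[OF L])
    then show ?thesis using x by (simp add: axes_rotation[OF L] axes_rotation[OF M])
  qed
  moreover have "directed_line (dline_image (rotation L \<theta>) M)"
    using axes_directed[OF L] axes_directed[OF M]
    by (simp add: directed_line_def dline_image_rotation norm_rot)
  ultimately show ?thesis by (simp add: axes_def)
qed

lemma axes_all_directions:
  assumes X: "X1 \<in> axes C" "X2 \<in> axes C" and np: "\<not> parallel X1 X2" and v: "norm v = 1"
  obtains L where "L \<in> axes C" and "dir L = v"
proof -
  have u: "norm (dir X1) = 1" "norm (dir X2) = 1"
    using X[THEN axes_directed] by (simp_all add: directed_line_def)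
  have "\<bar>dir X1 \<bullet> dir X2\<bar> \<noteq> norm (dir X1) * norm (dir X2)"
  proof
    assume "\<bar>dir X1 \<bullet> dir X2\<bar> = norm (dir X1) * norm (dir X2)"
    then have "dir X1 = 1 *\<^sub>R dir X2 \<or> dir X1 = (- 1) *\<^sub>R dir X2"
      using norm_cauchy_schwarz_abs_eq[of "dir X1" "dir X2"] u by auto
    then show False using np unfolding parallel_def by blast
  qed
  then have np': "\<bar>dir X1 \<bullet> dir X2\<bar> < 1"
    using Cauchy_Schwarz_ineq2[of "dir X1" "dir X2"] u by simp
  have "v \<in> dir ` axes C"
  proof (rule rot_closed_eq_sphere[of "dir ` axes C" "dir X1" "dir X2"])
    show "norm w = 1" if "w \<in> dir ` axes C" for w
      using that axes_directed by (auto simp: directed_line_def)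
    show "rot w \<theta> w' \<in> dir ` axes C" if w: "w \<in> dir ` axes C" "w' \<in> dir ` axes C" for w w' \<theta>
    proof -
      obtain L M where L: "w = dir L" "L \<in> axes C" and M: "w' = dir M" "M \<in> axes C"
        using w by blast
      then show ?thesis
        using axes_image[OF L(2) M(2)] dline_image_rotation(2) by (metis imageI)
    qed
  qed (use X v np' in auto)
  then show ?thesis using that by blast
qed

section \<open>Translations preserving a set\<close>

text \<open>The vectors by which \<open>C\<close> can be translated into itself.\<close>

definition period_set :: "point set \<Rightarrow> point set" where
  "period_set C = {w. \<forall>x\<in>C. x + w \<in> C}"

lemma period_set_add:
  "v \<in> period_set C \<Longrightarrow> w \<in> period_set C \<Longrightarrow> v + w \<in> period_set C"
  by (auto simp: period_set_def simp flip: add.assoc)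

lemma period_set_rot:
  assumes L: "L \<in> axes C" and w: "w \<in> period_set C"
  shows "rot (dir L) \<theta> w \<in> period_set C"
  unfolding period_set_def
proof safe
  fix x assume "x \<in> C"
  then have "rotation L \<theta> (rotation L (- \<theta>) x + w) \<in> C"
    using w by (auto simp: period_set_def intro!: axes_rotation[OF L])
  moreover have "rotation L \<theta> (y + w) = rotation L \<theta> y + rot (dir L) \<theta> w" for y
  proof -
    have "y + w - base L = (y - base L) + w" by simp
    then show ?thesis by (simp only: rotation_eq_rot linear_add[OF linear_rot] add.assoc)
  qed
  ultimately show "x + rot (dir L) \<theta> w \<in> C"
    using axes_directed[OF L] by (simp add: rotation_rotation)
qed

lemma nonzero_translation:
  assumes X: "X1 \<in> axes C" "X2 \<in> axes C" and sk: "skew X1 X2"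
  obtains w where "w \<in> period_set C" and "w \<noteq> 0"
proof -
  define N where "N = cross3 (dir X1) (dir X2)"
  define n where "n = N /\<^sub>R norm N"
  note d = X[THEN axes_directed]
  have "N \<noteq> 0" using skew_cross_nonzero[OF d sk] by (auto simp: N_def)
  have n: "norm n = 1" using \<open>N \<noteq> 0\<close> by (simp add: n_def)
  have perp: "n \<bullet> dir X1 = 0" "n \<bullet> dir X2 = 0"
    by (simp_all add: n_def N_def dot_cross_self)
  have gap: "n \<bullet> (base X2 - base X1) \<noteq> 0"
    using skew_cross_nonzero[OF d sk] \<open>N \<noteq> 0\<close> by (simp add: n_def N_def[symmetric] inner_commute)
  obtain L where L: "L \<in> axes C" "dir L = n"
    using axes_all_directions[OF X _ n] sk by (auto simp: skew_def)
  obtain \<phi> where \<phi>: "rot n \<phi> (dir X1) = dir X2"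
    using rot_circle[of n "dir X1" "dir X2"] n perp d by (auto simp: directed_line_def)
  \<comment> \<open>A line with the direction of \<open>X2\<close>, at the height of \<open>X1\<close> along \<open>n\<close>.\<close>
  define Y where "Y = dline_image (rotation L \<phi>) X1"
  have Y: "Y \<in> axes C" "dir Y = dir X2" "base Y = rotation L \<phi> (base X1)"
    by (simp_all add: Y_def axes_image L X dline_image_rotation \<phi>)
  define w where "w = 2 *\<^sub>R (base X2 - base Y - (dir X2 \<bullet> (base X2 - base Y)) *\<^sub>R dir X2)"
  have "w \<in> period_set C"
    using axes_rotation[OF X(2) axes_rotation[OF Y(1)], of _ pi pi]
    by (simp add: period_set_def w_def half_turns_parallel[OF axes_directed[OF Y(1)] Y(2)])
  moreover have "n \<bullet> rotation L \<phi> x = n \<bullet> x" for x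
    unfolding L(2)[symmetric] by (rule inner_axis_rotation[OF axes_directed[OF L(1)]])
  then have "n \<bullet> w = 2 * (n \<bullet> (base X2 - base X1))"
    by (simp add: w_def inner_diff_right perp Y(3))
  then have "w \<noteq> 0" using gap by auto
  ultimately show ?thesis by (rule that)
qed

text \<open>\<open>w\<close> can be rotated to any vector \<open>v\<close> of the same length, about an axis perpendicular to
  \<open>w - v\<close>.\<close>

lemma period_set_sphere:
  assumes dirs: "\<And>v. norm v = 1 \<Longrightarrow> \<exists>L\<in>axes C. dir L = v"
    and w: "w \<in> period_set C" and n: "norm v = norm w"
  shows "v \<in> period_set C"
proof -
  obtain u where u: "norm u = 1" "u \<bullet> w = u \<bullet> v"
  proof -
    obtain z where z: "z \<noteq> 0" "z \<bullet> (w - v) = 0"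
      using orthogonal_to_vector_exists[of "w - v"] by (auto simp: orthogonal_def inner_commute)
    show ?thesis
      using z by (intro that[of "z /\<^sub>R norm z"]) (simp_all add: inner_diff_right)
  qed
  obtain \<theta> where "rot u \<theta> w = v" using rot_circle[OF u] n by metis
  moreover obtain L where "L \<in> axes C" "dir L = u" using dirs u by blast
  ultimately show ?thesis using period_set_rot[OF _ w] by blast
qed

lemma period_set_all:
  assumes dirs: "\<And>v. norm v = 1 \<Longrightarrow> \<exists>L\<in>axes C. dir L = v"
    and w: "w \<in> period_set C" and "w \<noteq> 0"
  shows "v \<in> period_set C"
proof -
  have small: "x \<in> period_set C" if x: "norm x \<le> norm w" for x
  proof -
    \<comment> \<open>\<open>x\<close> is the sum of the two vectors \<open>x/2 + y\<close> and \<open>x/2 - y\<close> of the length of \<open>w\<close>, with \<open>y\<close>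
      perpendicular to \<open>x\<close>.\<close>
    obtain z where z: "z \<noteq> 0" "x \<bullet> z = 0"
      using orthogonal_to_vector_exists[of x] by (auto simp: orthogonal_def)
    define s where "s = sqrt ((norm w)\<^sup>2 - (norm x / 2)\<^sup>2)"
    define y where "y = (s / norm z) *\<^sub>R z"
    have "norm x / 2 \<le> norm w" using x norm_ge_zero[of x] by linarith
    then have "(norm x / 2)\<^sup>2 \<le> (norm w)\<^sup>2" by (intro power_mono) auto
    then have "y \<bullet> y = w \<bullet> w - (x \<bullet> x) / 4"
      using z by (simp add: y_def s_def power2_norm_eq_inner[symmetric] power_divide power_mult_distrib)
    moreover have "x \<bullet> y = 0" using z by (simp add: y_def)
    ultimately have "(norm ((1/2) *\<^sub>R x + y))\<^sup>2 = (norm w)\<^sup>2"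
      "(norm ((1/2) *\<^sub>R x - y))\<^sup>2 = (norm w)\<^sup>2"
      unfolding power2_norm_eq_inner
      by (simp_all add: inner_add_left inner_add_right inner_diff_left inner_diff_right
          inner_commute[of y x])
    then have "norm ((1/2) *\<^sub>R x + y) = norm w" "norm ((1/2) *\<^sub>R x - y) = norm w"
      by (simp_all add: power2_eq_iff_nonneg)
    then have "((1/2) *\<^sub>R x + y) + ((1/2) *\<^sub>R x - y) \<in> period_set C"
      by (intro period_set_add period_set_sphere[OF dirs w])
    then show ?thesis by (simp flip: scaleR_2)
  qed
  obtain k :: nat where k: "norm v / norm w < real k" using reals_Archimedean2 by blast
  then have "k > 0" using assms(3)
    by (metis divide_nonneg_nonneg gr0I norm_ge_zero not_less of_nat_0)
  have "real m *\<^sub>R (v /\<^sub>R real k) \<in> period_set C" for m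
  proof (induction m)
    case 0
    show ?case by (simp add: period_set_def)
  next
    case (Suc m)
    have "norm (v /\<^sub>R real k) \<le> norm w"
      using k \<open>k > 0\<close> \<open>w \<noteq> 0\<close> by (simp add: field_simps)
    then show ?case
      using period_set_add[OF Suc small] by (simp add: algebra_simps)
  qed
  from this[of k] show ?thesis using \<open>k > 0\<close> by simp
qed

lemma invariant_eq_UNIV:
  assumes X: "X1 \<in> axes C" "X2 \<in> axes C" and sk: "skew X1 X2" and "C \<noteq> {}"
  shows "C = UNIV"
proof -
  obtain x where x: "x \<in> C" using \<open>C \<noteq> {}\<close> by blast
  have dirs: "\<exists>L\<in>axes C. dir L = v" if "norm v = 1" for v
    using axes_all_directions[OF X _ that] sk unfolding skew_def by metis
  obtain w where w: "w \<in> period_set C" "w \<noteq> 0"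
    using nonzero_translation[OF X sk] .
  have "y - x \<in> period_set C" for y using period_set_all[OF dirs w] by blast
  then have "x + (y - x) \<in> C" for y using x unfolding period_set_def by blast
  then show ?thesis by auto
qed

section \<open>Rotations of infinite order\<close>

lemma infinite_order_irrational:
  assumes L: "directed_line L" and "infinite_order (rotation L t)"
  shows "t / (2 * pi) \<notin> \<rat>"
proof
  assume "t / (2 * pi) \<in> \<rat>"
  then obtain a b :: int where b: "b > 0" and "t / (2 * pi) = of_int a / of_int b"
    by (rule Rats_cases')
  then have "real (nat b) * t = 2 * pi * of_int a" by (simp add: field_simps)
  then have "rotation L t ^^ nat b = rotation L (2 * pi * of_int a)"
    by (simp add: rotation_funpow[OF L])
  also have "\<dots> = id"
    by (simp add: fun_eq_iff rotation_def Let_def cos_int_2pin sin_int_2pin)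
  finally show False using assms(2) b by (auto simp: infinite_order_def)
qed

text \<open>The angles \<open>\<theta>\<close> for which \<open>rotation L \<theta>\<close> maps a given point of \<open>C\<close> into \<open>C\<close> form a closed set, which
  contains all numbers \<open>k t - 2 \<pi> h\<close> with integers \<open>h\<close> and \<open>k > 0\<close>; these are dense.\<close>

lemma infinite_order_axes:
  assumes L: "directed_line L" and inf: "infinite_order (rotation L t)"
    and C: "closed C" and inv: "\<And>x. x \<in> C \<Longrightarrow> rotation L t x \<in> C"
  shows "L \<in> axes C"
proof -
  have "rotation L \<theta> x \<in> C" if x: "x \<in> C" for \<theta> x
  proof -
    let ?S = "{s. rotation L s x \<in> C}"
    have "continuous_on UNIV (\<lambda>s. rotation L s x)"
      unfolding rotation_def Let_def by (intro continuous_intros)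
    then have "closed ?S"
      using continuous_closed_preimage[OF _ closed_UNIV C, of "\<lambda>s. rotation L s x"]
      by (simp add: vimage_def)
    moreover have "\<theta> \<in> closure ?S"
      unfolding closure_approachable
    proof safe
      fix e :: real assume "e > 0"
      then obtain h k where k: "k > 0"
        "\<bar>of_int k * (t / (2 * pi)) - of_int h - \<theta> / (2 * pi)\<bar> < e / (2 * pi)"
        using sequence_of_fractional_parts_is_dense[OF infinite_order_irrational[OF L inf],
            of "e / (2 * pi)" "\<theta> / (2 * pi)"] pi_gt_zero
        by (metis divide_pos_pos zero_less_mult_iff zero_less_numeral)
      define s where "s = real (nat k) * t - 2 * pi * of_int h"
      have "s - \<theta> = 2 * pi * (of_int k * (t / (2 * pi)) - of_int h - \<theta> / (2 * pi))"
        using k(1) by (simp add: s_def field_simps)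
      then have "dist s \<theta> < e"
        using k(2) by (simp add: dist_real_def abs_mult pos_less_divide_eq mult.commute)
      moreover have "rotation L (real m * t) x \<in> C" for m
        using x inv by (induction m)
          (simp_all add: rotation_rotation[OF L, symmetric] distrib_right)
      moreover have "rotation L s = rotation L (real (nat k) * t)"
        by (simp add: s_def fun_eq_iff rotation_def Let_def cos_diff sin_diff
            cos_int_2pin sin_int_2pin)
      ultimately show "\<exists>y\<in>?S. dist y \<theta> < e" by (intro bexI[of _ s]) simp_all
    qed
    ultimately show ?thesis by (simp add: closure_closed)
  qed
  then show ?thesis using L by (simp add: axes_def)
qed

section \<open>Density of the orbit\<close>

theorem theorem3p4:
  fixes X\<^sub>1 X\<^sub>2 :: dline and r\<^sub>1 r\<^sub>2 :: transf and P :: point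
  assumes "directed_line X\<^sub>1" and "directed_line X\<^sub>2"
    and "skew X\<^sub>1 X\<^sub>2"
    and "rotation_about X\<^sub>1 r\<^sub>1" and "infinite_order r\<^sub>1"
    and "rotation_about X\<^sub>2 r\<^sub>2" and "infinite_order r\<^sub>2"
  shows "closure {f P | f. f \<in> peripatetic {(X\<^sub>1, r\<^sub>1), (X\<^sub>2, r\<^sub>2)}} = UNIV"
proof -
  let ?R = "{(X\<^sub>1, r\<^sub>1), (X\<^sub>2, r\<^sub>2)}"
  let ?O = "{f P | f. f \<in> peripatetic ?R}"
  have R: "directed_line A \<and> rotation_about A r" if "(A, r) \<in> ?R" for A r
    using that assms by auto
  have ax: "A \<in> axes (closure ?O)" if Ar: "(A, r) \<in> ?R" and inf: "infinite_order r" for A r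
  proof -
    obtain t where r: "r = rotation A t" using R[OF Ar] by (auto simp: rotation_about_def)
    have "continuous_on (closure ?O) r"
      unfolding r rotation_eq_rot[abs_def] rot_def
      by (intro continuous_intros continuous_on_cross)
    moreover have "r ` ?O \<subseteq> closure ?O"
    proof safe
      fix f assume "f \<in> peripatetic ?R"
      then have "r \<circ> f \<in> peripatetic ?R"
        using peripatetic_comp_left[of ?R, OF R Ar] by blast
      then have "(r \<circ> f) P \<in> ?O" by blast
      then have "(r \<circ> f) P \<in> closure ?O" by (rule subsetD[OF closure_subset])
      then show "r (f P) \<in> closure ?O" by simp
    qed
    ultimately have "r ` closure ?O \<subseteq> closure ?O"
      by (intro image_closure_subset) auto
    then have "rotation A t x \<in> closure ?O" if "x \<in> closure ?O" for x
      using that unfolding r by blast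
    then show ?thesis
      using R[OF Ar] inf unfolding r by (intro infinite_order_axes[of _ t]) simp_all
  qed
  show ?thesis
  proof (rule invariant_eq_UNIV)
    show "X\<^sub>1 \<in> axes (closure ?O)" "X\<^sub>2 \<in> axes (closure ?O)"
      using ax assms(5,7) by auto
    show "skew X\<^sub>1 X\<^sub>2" by fact
    have "id P \<in> ?O" using peripatetic.id[of ?R] by blast
    then show "closure ?O \<noteq> {}" by auto
  qed
qed

end
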